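(* Let $m_1,m_2\in\mathbb{N}=\{0,1,2,\dots\}$, not both zero, and let $\Omega\subset\mathbb{R}^2$ be a nonempty, bounded, open, simply connected set with piecewise $C^1$ boundary which is $D$-star-shaped for $D=-(m_1+2)x\,\partial_x-(m_2+2)y\,\partial_y$. Let $p\ge 1$ be a real number and suppose there exists a constant $C>0$, independent of $u$, such that $$\|u\|_{L^p(\Omega)}\leq C\,\|\nabla_{m_1,m_2}u\|_{L^2(\Omega)}\qquad\text{for all } u\in C^\infty_0(\Omega).$$ Then $$1\leq p\leq 2^*(m_1,m_2):=\frac{2(m_1+m_2)+8}{m_1+m_2+m_1m_2}.$$
   Context: $C_0^\infty(\Omega)$ denotes smooth real-valued functions with compact support in $\Omega$. The weighted gradient is $\nabla_{m_1,m_2}u:=\left(|y|^{m_1/2}u_x,\ |x|^{m_2/2}u_y\right)$, so that $\|\nabla_{m_1,m_2}u\|_{L^2(\Omega)}^2=\int_\Omega\left(|y|^{m_1}u_x^2+|x|^{m_2}u_y^2\right)dx\,dy$. An open set $\Omega\subset\mathbb{R}^2$ is $D$-star-shaped, for $D=-(m_1+2)x\,\partial_x-(m_2+2)y\,\partial_y$, if for each $(x_0,y_0)\in\overline{\Omega}$ one has $\mathcal{F}_t(x_0,y_0)\in\overline{\Omega}$ for every $t\in[0,+\infty]$, where $\mathcal{F}_t(x_0,y_0)=(x_0e^{-(m_1+2)t},\,y_0e^{-(m_2+2)t})$ is the flow of $D$ and $\mathcal{F}_{+\infty}(x_0,y_0)=(0,0)$. *)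

theory Defs
  imports "HOL-Analysis.Analysis"
begin

definition partial_x :: "(real \<times> real \<Rightarrow> real) \<Rightarrow> real \<times> real \<Rightarrow> real" where
  "partial_x u z = deriv (\<lambda>s. u (s, snd z)) (fst z)"

definition partial_y :: "(real \<times> real \<Rightarrow> real) \<Rightarrow> real \<times> real \<Rightarrow> real" where
  "partial_y u z = deriv (\<lambda>s. u (fst z, s)) (snd z)"

text \<open>Total differentiability is required at each level because \<^const>\<open>deriv\<close> is an
  arbitrary value where the derivative does not exist.\<close>

primrec C_diff :: "nat \<Rightarrow> (real \<times> real \<Rightarrow> real) \<Rightarrow> bool" where
  "C_diff 0 u \<longleftrightarrow> continuous_on UNIV u"
| "C_diff (Suc k) u \<longleftrightarrow>
     (\<forall>z. u differentiable (at z)) \<and> C_diff k (partial_x u) \<and> C_diff k (partial_y u)"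

text \<open>Functions on \<open>\<Omega>\<close> with compact support in \<open>\<Omega>\<close> are represented by their extension
  by zero, which is again smooth.\<close>

definition C0_infinity :: "(real \<times> real) set \<Rightarrow> (real \<times> real \<Rightarrow> real) set" where
  "C0_infinity \<Omega> = {u. (\<forall>k. C_diff k u) \<and>
     compact (closure {z. u z \<noteq> 0}) \<and> closure {z. u z \<noteq> 0} \<subseteq> \<Omega>}"

definition Lp_norm :: "real \<Rightarrow> (real \<times> real) set \<Rightarrow> (real \<times> real \<Rightarrow> 'b::real_normed_vector) \<Rightarrow> real"
  where
  "Lp_norm p \<Omega> f = (LINT z:\<Omega>|lborel. norm (f z) powr p) powr (1 / p)"

text \<open>\<open>sqrt a ^ m\<close> stands for \<open>a\<close> to the power \<open>m/2\<close>: unlike \<open>a powr (m/2)\<close>, it equals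
  \<open>1\<close> for \<open>m = 0\<close> also where \<open>a = 0\<close>.\<close>

definition weighted_grad ::
    "nat \<Rightarrow> nat \<Rightarrow> (real \<times> real \<Rightarrow> real) \<Rightarrow> real \<times> real \<Rightarrow> real \<times> real" where
  "weighted_grad m1 m2 u z =
     (sqrt \<bar>snd z\<bar> ^ m1 * partial_x u z, sqrt \<bar>fst z\<bar> ^ m2 * partial_y u z)"

text \<open>The flow of \<open>D = -(m1 + 2) x \<partial>\<^sub>x - (m2 + 2) y \<partial>\<^sub>y\<close>; only times
  \<open>t \<in> [0, \<infinity>]\<close> are meaningful.\<close>

definition D_flow :: "nat \<Rightarrow> nat \<Rightarrow> ereal \<Rightarrow> real \<times> real \<Rightarrow> real \<times> real" where
  "D_flow m1 m2 t z =
     (if t = \<infinity> then (0, 0)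
      else (fst z * exp (- ((real m1 + 2) * real_of_ereal t)),
            snd z * exp (- ((real m2 + 2) * real_of_ereal t))))"

definition D_star_shaped :: "nat \<Rightarrow> nat \<Rightarrow> (real \<times> real) set \<Rightarrow> bool" where
  "D_star_shaped m1 m2 \<Omega> \<longleftrightarrow>
     (\<forall>z\<in>closure \<Omega>. \<forall>t\<in>{0..\<infinity>}. D_flow m1 m2 t z \<in> closure \<Omega>)"

text \<open>A regular \<open>C\<^sup>1\<close> arc up to its endpoints. The library notion
  \<^const>\<open>piecewise_C1_differentiable_on\<close> is not used for boundaries, since it requires neither
  one-sided derivatives at the break points nor a nonvanishing tangent.\<close>

definition regular_C1_on :: "(real \<Rightarrow> real \<times> real) \<Rightarrow> real set \<Rightarrow> bool" where
  "regular_C1_on g I \<longleftrightarrow>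
     (\<exists>g'. continuous_on I g' \<and>
        (\<forall>t\<in>I. (g has_vector_derivative g' t) (at t within I) \<and> g' t \<noteq> 0))"

definition piecewise_C1_Jordan_curve :: "(real \<times> real) set \<Rightarrow> bool" where
  "piecewise_C1_Jordan_curve \<Gamma> \<longleftrightarrow>
     (\<exists>g. simple_path g \<and> pathfinish g = pathstart g \<and> path_image g = \<Gamma> \<and>
        (\<exists>(n::nat) s. s 0 = 0 \<and> s n = 1 \<and>
           (\<forall>i<n. s i < s (Suc i) \<and> regular_C1_on g {s i..s (Suc i)})))"

text \<open>A bounded planar domain has piecewise \<open>C\<^sup>1\<close> boundary if its boundary consists of
  finitely many disjoint piecewise \<open>C\<^sup>1\<close> Jordan curves (exactly one if the domain is simply
  connected). Corners and cusps are allowed, slits are not.\<close>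

definition piecewise_C1_boundary :: "(real \<times> real) set \<Rightarrow> bool" where
  "piecewise_C1_boundary \<Omega> \<longleftrightarrow>
     (\<exists>\<C>. finite \<C> \<and> pairwise disjnt \<C> \<and> (\<forall>\<Gamma>\<in>\<C>. piecewise_C1_Jordan_curve \<Gamma>) \<and>
        frontier \<Omega> = \<Union>\<C>)"

definition critical_exponent :: "nat \<Rightarrow> nat \<Rightarrow> real" where
  "critical_exponent m1 m2 =
     (2 * (real m1 + real m2) + 8) / (real m1 + real m2 + real m1 * real m2)"

end

theory Submission
  imports Defs
begin

text \<open>
  The inequality is tested on one bump function concentrated along the flow of \<open>D\<close>. Put
  \<open>a = m1 + 2\<close>, \<open>b = m2 + 2\<close>, fix a nonzero \<open>u \<in> C0_infinity \<Omega>\<close> and let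
  \<open>u\<^sub>t(x, y) = u (exp (a t) x, exp (b t) y)\<close> for \<open>t \<ge> 0\<close>. The dilation multiplies area by
  \<open>exp ((a + b) t)\<close>, hence
  \<open>\<parallel>u\<^sub>t\<parallel>\<^sub>p = exp (- (a + b) t / p) \<parallel>u\<parallel>\<^sub>p\<close>. The exponents \<open>a\<close> and \<open>b\<close> are such that
  the weights \<open>|y|\<^bsup>m1/2\<^esup>\<close> and \<open>|x|\<^bsup>m2/2\<^esup>\<close> make both components of the weighted gradient
  scale by the same factor \<open>exp ((2 - m1 m2 / 2) t)\<close> (lemma \<open>weighted_grad_stretch\<close>), and so
  the \<open>L\<^sup>2\<close> norm of the gradient is multiplied by \<open>exp (- Q t / 2)\<close> with
  \<open>Q = m1 + m2 + m1 m2\<close> (lemma \<open>Lp_norm_stretch\<close>). The embedding inequality for all \<open>u\<^sub>t\<close> then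
  bounds \<open>exp ((Q / 2 - (a + b) / p) t)\<close> uniformly in \<open>t \<ge> 0\<close>. Therefore
  \<open>Q / 2 \<le> (a + b) / p\<close>, which is \<open>p \<le> critical_exponent m1 m2\<close>.

  The geometry enters through the requirement that \<open>u\<^sub>t\<close> be supported in \<open>\<Omega>\<close>. Being
  \<open>D\<close>-star-shaped is a property of the closure of \<open>\<Omega>\<close>: the contracted copies of \<open>\<Omega>\<close> are open
  subsets of that closure, and a slit in \<open>\<Omega>\<close> could cut through them. Lemma
  \<open>interior_closure_Jordan_domain\<close> excludes this by the Jordan curve theorem: a connected open
  set bounded by Jordan curves is the interior of its closure.
\<close>

section \<open>Domains lie on one side of their Jordan boundary curves\<close>

text \<open>The Jordan curve theorem, carried from the complex plane to \<open>\<real> \<times> \<real>\<close> by the linear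
  isomorphism \<open>(x, y) \<mapsto> x + i y\<close>.\<close>

lemma Jordan_curve_two_sides:
  assumes "piecewise_C1_Jordan_curve \<Gamma>"
  obtains A B where "open A" "open B" "A \<inter> B = {}" "A \<union> B = - \<Gamma>"
    "\<Gamma> \<subseteq> closure A" "\<Gamma> \<subseteq> closure B"
proof -
  obtain g where g: "simple_path g" "pathfinish g = pathstart g" "path_image g = \<Gamma>"
    using assms unfolding piecewise_C1_Jordan_curve_def by blast
  define h :: "real \<times> real \<Rightarrow> complex" where "h z = Complex (fst z) (snd z)" for z
  define k :: "complex \<Rightarrow> real \<times> real" where "k w = (Re w, Im w)" for w
  have kh: "k (h z) = z" and hk: "h (k w) = w" for z w
    by (simp_all add: h_def k_def)
  have lin: "linear h"
    by (rule linearI) (simp_all add: h_def complex_eq_iff)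
  have conth: "continuous_on UNIV h"
    using lin linear_continuous_on linear_linear by blast
  have contk: "continuous_on UNIV k"
    unfolding k_def by (intro continuous_intros)
  have "inj h" by (metis injI kh)
  define c where "c = h \<circ> g"
  have c: "simple_path c" "pathfinish c = pathstart c" "path_image c = h ` \<Gamma>"
    using g lin \<open>inj h\<close>
    by (auto simp: c_def simple_path_linear_image_eq pathfinish_compose pathstart_compose
        path_image_compose)
  note J = Jordan_inside_outside[OF c(1,2)]
  have pre: "h -` S = k ` S" for S
    by (auto simp: hk kh image_iff) (metis kh)
  have op: "open (h -` S)" if "open S" for S
    using open_vimage[OF that conth] .
  have cl: "\<Gamma> \<subseteq> closure (h -` S)" if "frontier S = path_image c" for S
  proof
    fix z assume "z \<in> \<Gamma>"
    then have "h z \<in> closure S"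
      using that c(3) by (auto simp: frontier_def)
    moreover have "k ` closure S \<subseteq> closure (k ` S)"
      by (rule image_closure_subset)
        (auto intro: continuous_on_subset[OF contk] closure_subset[THEN subsetD])
    ultimately show "z \<in> closure (h -` S)"
      using kh pre by (metis image_subset_iff)
  qed
  show thesis
  proof (rule that[of "h -` inside (path_image c)" "h -` outside (path_image c)"])
    show "h -` inside (path_image c) \<union> h -` outside (path_image c) = - \<Gamma>"
      using J c(3) \<open>inj h\<close> by (metis inj_vimage_image_eq vimage_Compl vimage_Un)
    show "h -` inside (path_image c) \<inter> h -` outside (path_image c) = {}"
      using J by (metis vimage_Int vimage_empty)
  qed (use J op cl in auto)
qed

text \<open>A connected set that avoids a Jordan curve stays on one of its sides, so near every point of
  the curve there are points of the other side, which the closure of the set does not reach.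
  No boundary point is therefore interior to the closure.\<close>

lemma interior_closure_Jordan_domain:
  assumes "open \<Omega>" "connected \<Omega>" "piecewise_C1_boundary \<Omega>"
  shows "interior (closure \<Omega>) = \<Omega>"
proof
  show "\<Omega> \<subseteq> interior (closure \<Omega>)"
    using assms(1) closure_subset interior_maximal by blast
  show "interior (closure \<Omega>) \<subseteq> \<Omega>"
  proof (rule ccontr)
    assume "\<not> interior (closure \<Omega>) \<subseteq> \<Omega>"
    then obtain z where z: "z \<in> interior (closure \<Omega>)" "z \<notin> \<Omega>" by blast
    then have "z \<in> frontier \<Omega>"
      using assms(1) interior_subset by (auto simp: frontier_def interior_open)
    then obtain \<Gamma> where \<Gamma>: "piecewise_C1_Jordan_curve \<Gamma>" "z \<in> \<Gamma>" "\<Gamma> \<subseteq> frontier \<Omega>"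
      using assms(3) unfolding piecewise_C1_boundary_def by (metis Union_iff Union_upper)
    obtain A B where AB: "open A" "open B" "A \<inter> B = {}" "A \<union> B = - \<Gamma>"
        "\<Gamma> \<subseteq> closure A" "\<Gamma> \<subseteq> closure B"
      using Jordan_curve_two_sides[OF \<Gamma>(1)] by metis
    have meets: "S \<inter> \<Omega> \<noteq> {}" if "open S" "\<Gamma> \<subseteq> closure S" for S
    proof -
      have "interior (closure \<Omega>) \<inter> S \<noteq> {}"
        using z(1) \<Gamma>(2) that(2) open_Int_closure_eq_empty[of "interior (closure \<Omega>)" S] by auto
      then have "(interior (closure \<Omega>) \<inter> S) \<inter> closure \<Omega> \<noteq> {}"
        using interior_subset by blast
      then have "(interior (closure \<Omega>) \<inter> S) \<inter> \<Omega> \<noteq> {}"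
        using open_Int_closure_eq_empty[of "interior (closure \<Omega>) \<inter> S" \<Omega>] that(1) by auto
      then show ?thesis by blast
    qed
    have "\<Omega> \<subseteq> A \<union> B"
      using AB(4) \<Gamma>(3) assms(1) by (auto simp: frontier_def interior_open)
    then show False
      using connectedD[OF assms(2) AB(1,2)] meets[OF AB(1,5)] meets[OF AB(2,6)] AB(3) by blast
  qed
qed

section \<open>Smooth functions of two variables\<close>

text \<open>The next two lemmas reduce the calculus of \<^const>\<open>partial_x\<close> and \<^const>\<open>partial_y\<close> to
  that of total derivatives and their sum, product and chain rules.\<close>

lemma partial_x_eq_derivative:
  assumes "(u has_derivative L) (at z)"
  shows "partial_x u z = L (1, 0)"
proof -
  have "((\<lambda>s. (s, snd z)) has_derivative (\<lambda>h. (h, 0))) (at (fst z))"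
    by (auto intro!: derivative_eq_intros)
  then have "((\<lambda>s. u (s, snd z)) has_derivative (\<lambda>h. L (h, 0))) (at (fst z))"
    using has_derivative_compose[of "\<lambda>s. (s, snd z)" "\<lambda>h. (h, 0)" "fst z" UNIV u L] assms by simp
  moreover have "(\<lambda>h. L (h, 0)) = (*) (L (1, 0))"
  proof
    show "L (h, 0) = L (1, 0) * h" for h
      using linear_cmul[OF has_derivative_linear[OF assms], of h "(1, 0)"] by simp
  qed
  ultimately have "((\<lambda>s. u (s, snd z)) has_real_derivative L (1, 0)) (at (fst z))"
    by (simp add: has_field_derivative_def)
  then show ?thesis
    unfolding partial_x_def by (rule DERIV_imp_deriv)
qed

lemma partial_y_eq_derivative:
  assumes "(u has_derivative L) (at z)"
  shows "partial_y u z = L (0, 1)"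
proof -
  have "((\<lambda>s. (fst z, s)) has_derivative (\<lambda>h. (0, h))) (at (snd z))"
    by (auto intro!: derivative_eq_intros)
  then have "((\<lambda>s. u (fst z, s)) has_derivative (\<lambda>h. L (0, h))) (at (snd z))"
    using has_derivative_compose[of "\<lambda>s. (fst z, s)" "\<lambda>h. (0, h)" "snd z" UNIV u L] assms by simp
  moreover have "(\<lambda>h. L (0, h)) = (*) (L (0, 1))"
  proof
    show "L (0, h) = L (0, 1) * h" for h
      using linear_cmul[OF has_derivative_linear[OF assms], of h "(0, 1)"] by simp
  qed
  ultimately have "((\<lambda>s. u (fst z, s)) has_real_derivative L (0, 1)) (at (snd z))"
    by (simp add: has_field_derivative_def)
  then show ?thesis
    unfolding partial_y_def by (rule DERIV_imp_deriv)
qed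

lemma C_diff_SucD: "C_diff (Suc k) u \<Longrightarrow> C_diff k u"
proof (induction k arbitrary: u)
  case 0
  then show ?case
    by (simp add: continuous_at_imp_continuous_on differentiable_imp_continuous_within)
next
  case (Suc k)
  show ?case
    using Suc.prems Suc.IH by (metis C_diff.simps(2))
qed

lemma C_diff_imp_continuous: "C_diff k u \<Longrightarrow> continuous_on UNIV u"
proof (induction k)
  case (Suc k)
  show ?case by (rule Suc.IH[OF C_diff_SucD[OF Suc.prems]])
qed simp

lemma C_diff_const: "C_diff k (\<lambda>z. c)"
proof (induction k arbitrary: c)
  case (Suc k)
  have "partial_x (\<lambda>z. c) = (\<lambda>z. 0)" "partial_y (\<lambda>z. c) = (\<lambda>z. 0)"
    by (simp_all add: fun_eq_iff partial_x_def partial_y_def)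
  then show ?case using Suc by simp
qed simp

lemma C_diff_Suc_has_derivative:
  assumes "C_diff (Suc k) u"
  shows "(u has_derivative frechet_derivative u (at z)) (at z)"
proof -
  have "u differentiable (at z)" using assms by (simp del: split_paired_All)
  then show ?thesis by (rule frechet_derivative_works[THEN iffD1])
qed

lemma C_diff_add: "C_diff k u \<Longrightarrow> C_diff k v \<Longrightarrow> C_diff k (\<lambda>z. u z + v z)"
proof (induction k arbitrary: u v)
  case (Suc k)
  have der: "((\<lambda>z. u z + v z) has_derivative
      (\<lambda>h. frechet_derivative u (at z) h + frechet_derivative v (at z) h)) (at z)"
    and du: "(u has_derivative frechet_derivative u (at z)) (at z)"
    and dv: "(v has_derivative frechet_derivative v (at z)) (at z)" for z
    using Suc.prems[THEN C_diff_Suc_has_derivative] by (auto intro!: has_derivative_add)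
  have "partial_x (\<lambda>z. u z + v z) = (\<lambda>z. partial_x u z + partial_x v z)"
    "partial_y (\<lambda>z. u z + v z) = (\<lambda>z. partial_y u z + partial_y v z)"
    by (auto simp: fun_eq_iff partial_x_eq_derivative[OF der] partial_x_eq_derivative[OF du]
        partial_x_eq_derivative[OF dv] partial_y_eq_derivative[OF der]
        partial_y_eq_derivative[OF du] partial_y_eq_derivative[OF dv])
  then show ?case
    using Suc by (auto intro: differentiable_add)
qed (auto intro: continuous_intros)

lemma C_diff_mult: "C_diff k u \<Longrightarrow> C_diff k v \<Longrightarrow> C_diff k (\<lambda>z. u z * v z)"
proof (induction k arbitrary: u v)
  case (Suc k)
  have der: "((\<lambda>z. u z * v z) has_derivative
      (\<lambda>h. u z * frechet_derivative v (at z) h + frechet_derivative u (at z) h * v z)) (at z)"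
    and du: "(u has_derivative frechet_derivative u (at z)) (at z)"
    and dv: "(v has_derivative frechet_derivative v (at z)) (at z)" for z
    using Suc.prems[THEN C_diff_Suc_has_derivative] by (auto intro!: has_derivative_mult)
  have "partial_x (\<lambda>z. u z * v z) = (\<lambda>z. u z * partial_x v z + partial_x u z * v z)"
    "partial_y (\<lambda>z. u z * v z) = (\<lambda>z. u z * partial_y v z + partial_y u z * v z)"
    by (auto simp: fun_eq_iff partial_x_eq_derivative[OF der] partial_x_eq_derivative[OF du]
        partial_x_eq_derivative[OF dv] partial_y_eq_derivative[OF der]
        partial_y_eq_derivative[OF du] partial_y_eq_derivative[OF dv])
  moreover have "C_diff k u" "C_diff k v"
    using Suc.prems C_diff_SucD by blast+
  ultimately show ?case
    using Suc by (auto intro!: C_diff_add differentiable_mult)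
qed (auto intro: continuous_intros)

section \<open>Test functions\<close>

text \<open>The family generated by the flat function \<open>exp (- 1 / t)\<close>, extended by \<open>0\<close> to \<open>t \<le> 0\<close>.
  The polynomial factor in \<open>1 / t\<close> makes the family closed under differentiation, so smoothness
  follows by an induction over all members at once.\<close>

definition flat_exp :: "real poly \<Rightarrow> real \<Rightarrow> real" where
  "flat_exp P t = (if t > 0 then poly P (inverse t) * exp (- inverse t) else 0)"

lemma flat_exp_tendsto_0: "(flat_exp P \<longlongrightarrow> 0) (at 0)"
proof -
  have "((\<lambda>s. \<Sum>i\<le>degree P. coeff P i * (s ^ i / exp s)) \<longlongrightarrow>
      (\<Sum>i\<le>degree P. coeff P i * 0)) at_top"
    by (intro tendsto_sum tendsto_mult tendsto_const tendsto_power_div_exp_0)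
  moreover have "(\<Sum>i\<le>degree P. coeff P i * (s ^ i / exp s)) = poly P s * exp (- s)" for s
    by (simp add: poly_altdef sum_distrib_right exp_minus divide_inverse mult.assoc)
  ultimately have "((\<lambda>s. poly P s * exp (- s)) \<longlongrightarrow> 0) at_top"
    by simp
  then have "((\<lambda>t. poly P (inverse t) * exp (- inverse t)) \<longlongrightarrow> 0) (at_right 0)"
    by (rule filterlim_compose) (rule filterlim_inverse_at_top_right)
  then have "(flat_exp P \<longlongrightarrow> 0) (at_right 0)"
    by (rule Lim_transform_eventually)
      (auto simp: flat_exp_def eventually_at_filter intro!: always_eventually)
  moreover have "(flat_exp P \<longlongrightarrow> 0) (at_left 0)"
    by (rule Lim_transform_eventually[OF tendsto_const])
      (auto simp: flat_exp_def eventually_at_filter intro!: always_eventually)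
  ultimately show ?thesis
    by (simp add: filterlim_split_at)
qed

lemma flat_exp_has_derivative:
  "(flat_exp P has_real_derivative flat_exp ([:0, 0, 1:] * (P - pderiv P)) t) (at t)"
proof -
  consider "t > 0" | "t < 0" | "t = 0" by linarith
  then show ?thesis
  proof cases
    case 1
    have "((\<lambda>t. poly P (inverse t) * exp (- inverse t)) has_real_derivative
        flat_exp ([:0, 0, 1:] * (P - pderiv P)) t) (at t)"
      using 1 by (auto simp: flat_exp_def power2_eq_square algebra_simps
          intro!: derivative_eq_intros poly_DERIV[THEN DERIV_chain2])
    moreover have "\<forall>\<^sub>F s in nhds t. flat_exp P s = poly P (inverse s) * exp (- inverse s)"
      using eventually_nhds_in_open[of "{0<..}" t] 1
      by (auto elim!: eventually_mono simp: flat_exp_def)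
    ultimately show ?thesis
      by (simp add: DERIV_cong_ev)
  next
    case 2
    have "\<forall>\<^sub>F s in nhds t. flat_exp P s = 0"
      using eventually_nhds_in_open[of "{..<0}" t] 2
      by (auto elim!: eventually_mono simp: flat_exp_def)
    then show ?thesis
      using 2 by (simp add: DERIV_cong_ev flat_exp_def)
  next
    case 3
    \<comment> \<open>The difference quotient at the origin is itself a member of the family.\<close>
    have "(\<lambda>h. (flat_exp P (0 + h) - flat_exp P 0) / h) = flat_exp ([:0, 1:] * P)"
      by (auto simp: flat_exp_def field_simps)
    moreover have "flat_exp R 0 = 0" for R
      by (simp add: flat_exp_def)
    ultimately show ?thesis
      using 3 flat_exp_tendsto_0[of "[:0, 1:] * P"] by (simp only: DERIV_def)
  qed
qed

lemma C_diff_flat_exp_affine: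
  "C_diff k (\<lambda>z. flat_exp P (a * fst z + b * snd z + c))"
proof (induction k arbitrary: P)
  case 0
  have "continuous_on UNIV (flat_exp P)"
    using flat_exp_has_derivative by (meson DERIV_continuous_on has_field_derivative_at_within)
  then show ?case
    unfolding C_diff.simps by (rule continuous_on_compose2) (auto intro!: continuous_intros)
next
  case (Suc k)
  define Q where "Q = [:0, 0, 1:] * (P - pderiv P)"
  define l where "l z = a * fst z + b * snd z + c" for z :: "real \<times> real"
  have der: "((\<lambda>z. flat_exp P (l z)) has_derivative
      (\<lambda>h. flat_exp Q (l z) * (a * fst h + b * snd h))) (at z)" for z
  proof (rule has_derivative_compose[where f = l and g = "flat_exp P"
        and g' = "(*) (flat_exp Q (l z))"])
    show "(l has_derivative (\<lambda>h. a * fst h + b * snd h)) (at z)"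
      unfolding l_def by (auto intro!: derivative_eq_intros)
    show "(flat_exp P has_derivative (*) (flat_exp Q (l z))) (at (l z))"
      using flat_exp_has_derivative[of P "l z"] by (simp add: has_field_derivative_def Q_def)
  qed
  have "partial_x (\<lambda>z. flat_exp P (l z)) = (\<lambda>z. flat_exp Q (l z) * a)"
    "partial_y (\<lambda>z. flat_exp P (l z)) = (\<lambda>z. flat_exp Q (l z) * b)"
    by (auto simp: fun_eq_iff partial_x_eq_derivative[OF der] partial_y_eq_derivative[OF der])
  moreover have "C_diff k (\<lambda>z. flat_exp Q (l z) * d)" for d
    using Suc[of Q] by (auto intro!: C_diff_mult C_diff_const simp: l_def)
  moreover have "(\<lambda>z. flat_exp P (l z)) differentiable (at z)" for z
    using der differentiable_def by blast
  ultimately show ?case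
    by (simp add: l_def)
qed

text \<open>A product of four flat functions, one for each side of a rectangle, is nonzero exactly inside
  the rectangle.\<close>

lemma exists_bump_in_open_set:
  assumes "open \<Omega>" "\<Omega> \<noteq> {}"
  obtains u where "u \<in> C0_infinity \<Omega>" "{z. u z \<noteq> 0} \<noteq> {}"
proof -
  obtain z where "z \<in> \<Omega>" using assms(2) by blast
  then obtain a b where ab: "z \<in> box a b" "cbox a b \<subseteq> \<Omega>"
    using assms(1) open_contains_cbox by (metis)
  define u where "u w = flat_exp 1 (fst w - fst a) * flat_exp 1 (fst b - fst w) *
      (flat_exp 1 (snd w - snd a) * flat_exp 1 (snd b - snd w))" for w :: "real \<times> real"
  have supp: "{w. u w \<noteq> 0} = box a b"
    by (cases a; cases b) (auto simp: u_def flat_exp_def mem_box Basis_prod_def split: if_splits)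
  have aff: "C_diff k (\<lambda>w. flat_exp 1 (fst w - fst a))"
      "C_diff k (\<lambda>w. flat_exp 1 (fst b - fst w))"
      "C_diff k (\<lambda>w. flat_exp 1 (snd w - snd a))"
      "C_diff k (\<lambda>w. flat_exp 1 (snd b - snd w))" for k
    using C_diff_flat_exp_affine[of k 1 1 0 "- fst a"] C_diff_flat_exp_affine[of k 1 "-1" 0 "fst b"]
      C_diff_flat_exp_affine[of k 1 0 1 "- snd a"] C_diff_flat_exp_affine[of k 1 0 "-1" "snd b"]
    by simp_all
  have "closure {w. u w \<noteq> 0} = cbox a b"
    using ab(1) supp by (metis closure_box empty_iff)
  moreover have "C_diff k u" for k
    unfolding u_def by (intro C_diff_mult aff)
  ultimately have "u \<in> C0_infinity \<Omega>"
    using ab(2) by (simp add: C0_infinity_def compact_cbox del: compact_closure)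
  then show thesis
    using that supp ab(1) by (metis empty_iff)
qed

lemma gradient_zero_outside_support:
  assumes "z \<notin> closure {z. u z \<noteq> 0}"
  shows "partial_x u z = 0" "partial_y u z = 0"
proof -
  have "((\<lambda>z. 0) has_derivative (\<lambda>h. 0)) (at z)" by simp
  then have "(u has_derivative (\<lambda>h. 0)) (at z)"
    by (rule has_derivative_transform_within_open[where s = "- closure {z. u z \<noteq> 0}"])
      (use assms closure_subset[of "{z. u z \<noteq> 0}"] in \<open>blast | simp add: open_Compl\<close>)+
  then show "partial_x u z = 0" "partial_y u z = 0"
    using partial_x_eq_derivative partial_y_eq_derivative by metis+
qed

text \<open>Two things need care: \<open>|u|\<^sup>p\<close> must be integrable, since the integral is \<open>0\<close> by default
  otherwise, which follows from compact support; and the nonempty open set where \<open>u\<close> does not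
  vanish must have positive measure.\<close>

lemma Lp_norm_pos:
  assumes "u \<in> C0_infinity \<Omega>" "{z. u z \<noteq> 0} \<noteq> {}" "p > 0"
  shows "Lp_norm p UNIV u > 0"
proof -
  define K where "K = closure {z. u z \<noteq> 0}"
  define F where "F z = \<bar>u z\<bar> powr p" for z
  have contu: "continuous_on UNIV u" and K: "compact K"
    using assms(1) C_diff_imp_continuous by (auto simp: C0_infinity_def K_def)
  have "continuous_on UNIV F"
    unfolding F_def using contu assms(3) by (auto intro!: continuous_intros continuous_on_powr')
  then have "integrable lborel (\<lambda>z. indicator K z *\<^sub>R F z)"
    by (intro borel_integrable_compact K) (metis continuous_on_subset subset_UNIV)
  moreover have "(\<lambda>z. indicator K z *\<^sub>R F z) = F"
  proof
    show "indicator K z *\<^sub>R F z = F z" for z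
      using closure_subset[of "{z. u z \<noteq> 0}"]
      by (cases "u z = 0") (auto simp: K_def F_def)
  qed
  ultimately have int: "integrable lborel F" by simp
  have "integral\<^sup>L lborel F \<noteq> 0"
  proof
    assume "integral\<^sup>L lborel F = 0"
    then have "AE z in lborel. F z = 0"
      using int integral_nonneg_eq_0_iff_AE[of lborel F] by (simp add: F_def)
    moreover have "open {z. u z \<noteq> 0}"
      using open_vimage[OF _ contu, of "- {0}"] by (simp add: vimage_def open_Compl)
    ultimately have "{z. u z \<noteq> 0} \<in> null_sets lborel"
      by (subst AE_iff_null_sets) (auto simp: F_def elim!: eventually_mono)
    then have "negligible {z. u z \<noteq> 0}"
      by (simp add: negligible_iff_null_sets null_sets_completionI)
    then show False
      using assms(2) \<open>open {z. u z \<noteq> 0}\<close> open_not_negligible by blast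
  qed
  moreover have "integral\<^sup>L lborel F \<ge> 0"
    by (simp add: F_def)
  ultimately show ?thesis
    by (simp add: Lp_norm_def set_lebesgue_integral_def F_def[abs_def])
qed

section \<open>Anisotropic scaling\<close>

text \<open>The chain rule for axis-parallel dilations yields the partial derivatives and, by induction
  on the order, smoothness.\<close>

lemma C_diff_stretch:
  "C_diff k u \<Longrightarrow> C_diff k (\<lambda>z. u (\<alpha> * fst z, \<beta> * snd z))"
  and stretch_partials:
  "C_diff (Suc 0) u \<Longrightarrow> partial_x (\<lambda>z. u (\<alpha> * fst z, \<beta> * snd z)) =
     (\<lambda>z. \<alpha> * partial_x u (\<alpha> * fst z, \<beta> * snd z))"
  "C_diff (Suc 0) u \<Longrightarrow> partial_y (\<lambda>z. u (\<alpha> * fst z, \<beta> * snd z)) =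
     (\<lambda>z. \<beta> * partial_y u (\<alpha> * fst z, \<beta> * snd z))"
proof -
  define h where "h z = (\<alpha> * fst z, \<beta> * snd z)" for z :: "real \<times> real"
  have der: "((\<lambda>z. u (h z)) has_derivative (\<lambda>v. frechet_derivative u (at (h z)) (h v))) (at z)"
    if "u differentiable (at (h z))" for u :: "real \<times> real \<Rightarrow> real" and z
  proof (rule has_derivative_compose[where f = h and f' = h and g = u])
    show "(h has_derivative h) (at z)"
      unfolding h_def by (auto intro!: derivative_eq_intros)
    show "(u has_derivative frechet_derivative u (at (h z))) (at (h z))"
      using that frechet_derivative_works by blast
  qed
  have partials: "partial_x (\<lambda>z. u (h z)) = (\<lambda>z. \<alpha> * partial_x u (h z))"
      "partial_y (\<lambda>z. u (h z)) = (\<lambda>z. \<beta> * partial_y u (h z))"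
    if d: "\<And>z. u differentiable (at z)" for u :: "real \<times> real \<Rightarrow> real"
  proof -
    have L: "(u has_derivative frechet_derivative u (at w)) (at w)" for w
      using d frechet_derivative_works by blast
    have "frechet_derivative u (at w) (\<alpha>, 0) = \<alpha> * partial_x u w"
      "frechet_derivative u (at w) (0, \<beta>) = \<beta> * partial_y u w" for w
      using linear_cmul[OF has_derivative_linear[OF L], of w \<alpha> "(1, 0)"]
        linear_cmul[OF has_derivative_linear[OF L], of w \<beta> "(0, 1)"]
      by (simp_all add: partial_x_eq_derivative[OF L] partial_y_eq_derivative[OF L])
    then show "partial_x (\<lambda>z. u (h z)) = (\<lambda>z. \<alpha> * partial_x u (h z))"
      "partial_y (\<lambda>z. u (h z)) = (\<lambda>z. \<beta> * partial_y u (h z))"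
      using partial_x_eq_derivative[OF der[OF d]] partial_y_eq_derivative[OF der[OF d]]
      by (auto simp: h_def)
  qed
  have "C_diff k u \<Longrightarrow> C_diff k (\<lambda>z. u (h z))"
  proof (induction k arbitrary: u)
    case 0
    then have "continuous_on UNIV u" by simp
    then show ?case
      unfolding C_diff.simps h_def by (rule continuous_on_compose2) (auto intro!: continuous_intros)
  next
    case (Suc k)
    then have d: "\<And>z. u differentiable (at z)" by (simp del: split_paired_All)
    then have "(\<lambda>z. u (h z)) differentiable (at z)" for z
      using der[OF d] unfolding differentiable_def by blast
    then show ?case
      using Suc by (simp add: partials[OF d] C_diff_mult C_diff_const)
  qed
  then show "C_diff k u \<Longrightarrow> C_diff k (\<lambda>z. u (\<alpha> * fst z, \<beta> * snd z))"
    by (simp add: h_def)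
  show "C_diff (Suc 0) u \<Longrightarrow> partial_x (\<lambda>z. u (\<alpha> * fst z, \<beta> * snd z)) =
       (\<lambda>z. \<alpha> * partial_x u (\<alpha> * fst z, \<beta> * snd z))"
    "C_diff (Suc 0) u \<Longrightarrow> partial_y (\<lambda>z. u (\<alpha> * fst z, \<beta> * snd z)) =
       (\<lambda>z. \<beta> * partial_y u (\<alpha> * fst z, \<beta> * snd z))"
    by (rule partials[unfolded h_def], simp del: split_paired_All)+
qed

lemma lborel_integral_stretch:
  fixes F :: "real \<times> real \<Rightarrow> real"
  assumes [measurable]: "F \<in> borel_measurable borel" and "\<alpha> > 0" "\<beta> > 0"
  shows "(LINT z|lborel. F (\<alpha> * fst z, \<beta> * snd z)) = integral\<^sup>L lborel F / (\<alpha> * \<beta>)"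
proof -
  define h where "h z = (\<alpha> * fst z, \<beta> * snd z)" for z :: "real \<times> real"
  define c where "c j = (if j = (1, 0) then \<alpha> else \<beta>)" for j :: "real \<times> real"
  have "continuous_on UNIV h"
    unfolding h_def by (intro continuous_intros)
  then have [measurable]: "h \<in> borel_measurable borel"
    by (rule borel_measurable_continuous_onI)
  have basis: "(Basis :: (real \<times> real) set) = {(1, 0), (0, 1)}"
    by (auto simp: Basis_prod_def)
  have "(\<lambda>z. 0 + (\<Sum>j\<in>Basis. (c j * (z \<bullet> j)) *\<^sub>R j)) = h"
    by (auto simp: basis c_def h_def fun_eq_iff)
  moreover have "(\<Prod>j\<in>Basis. \<bar>c j\<bar>) = \<alpha> * \<beta>"
    using assms by (simp add: basis c_def)
  ultimately have "lborel = density (distr lborel borel h) (\<lambda>_. \<alpha> * \<beta>)"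
    using lborel_affine_euclidean[of c 0] assms by (simp add: c_def)
  then have "integral\<^sup>L lborel F = integral\<^sup>L (density (distr lborel borel h) (\<lambda>_. \<alpha> * \<beta>)) F"
    by simp
  also have "\<dots> = \<alpha> * \<beta> * (LINT z|lborel. F (h z))"
    using assms by (subst integral_density) (auto simp: integral_distr)
  finally show ?thesis
    using assms by (simp add: h_def)
qed

lemma Lp_norm_stretch:
  fixes f :: "real \<times> real \<Rightarrow> 'b::real_normed_vector"
  assumes f: "continuous_on UNIV f" and "\<alpha> > 0" "\<beta> > 0" "p > 0"
  shows "Lp_norm p UNIV (\<lambda>z. c *\<^sub>R f (\<alpha> * fst z, \<beta> * snd z)) =
    \<bar>c\<bar> * (\<alpha> * \<beta>) powr (- (1 / p)) * Lp_norm p UNIV f"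
proof -
  define F where "F z = norm (f z) powr p" for z
  have "(\<lambda>z. norm (f z)) \<in> borel_measurable borel"
    by (intro borel_measurable_continuous_onI continuous_on_norm f)
  then have [measurable]: "F \<in> borel_measurable borel"
    unfolding F_def by measurable
  have "0 \<le> integral\<^sup>L lborel F"
    by (simp add: F_def)
  have "(LINT z|lborel. norm (c *\<^sub>R f (\<alpha> * fst z, \<beta> * snd z)) powr p) =
      \<bar>c\<bar> powr p * (LINT z|lborel. F (\<alpha> * fst z, \<beta> * snd z))"
    by (simp add: F_def powr_mult)
  also have "\<dots> = \<bar>c\<bar> powr p * (inverse (\<alpha> * \<beta>) * integral\<^sup>L lborel F)"
    using assms by (simp add: lborel_integral_stretch divide_inverse mult_ac)
  finally have "Lp_norm p UNIV (\<lambda>z. c *\<^sub>R f (\<alpha> * fst z, \<beta> * snd z)) =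
      (\<bar>c\<bar> powr p * (inverse (\<alpha> * \<beta>) * integral\<^sup>L lborel F)) powr (1 / p)"
    by (simp add: Lp_norm_def set_lebesgue_integral_def)
  also have "\<dots> = \<bar>c\<bar> * (inverse (\<alpha> * \<beta>) powr (1 / p) * Lp_norm p UNIV f)"
    using assms \<open>0 \<le> integral\<^sup>L lborel F\<close>
    by (simp add: Lp_norm_def set_lebesgue_integral_def F_def[abs_def] powr_mult powr_powr)
  also have "inverse (\<alpha> * \<beta>) powr (1 / p) = (\<alpha> * \<beta>) powr (- (1 / p))"
    using assms by (simp add: powr_minus powr_mult inverse_powr)
  finally show ?thesis by (simp only: mult.assoc)
qed

lemma Lp_norm_eq_UNIV:
  assumes "\<And>z. z \<notin> \<Omega> \<Longrightarrow> f z = 0"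
  shows "Lp_norm p \<Omega> f = Lp_norm p UNIV f"
proof -
  have "indicator \<Omega> z *\<^sub>R norm (f z) powr p = indicator UNIV z *\<^sub>R norm (f z) powr p" for z
    by (cases "z \<in> \<Omega>") (simp_all add: assms)
  then show ?thesis
    unfolding Lp_norm_def set_lebesgue_integral_def by presburger
qed

text \<open>This is where the weights \<open>m1 + 2\<close> and \<open>m2 + 2\<close> of the flow come from. Dilating \<open>x\<close> by
  \<open>exp (a t)\<close> and \<open>y\<close> by \<open>exp (b t)\<close> multiplies the two gradient components by
  \<open>exp ((a - m1 b / 2) t)\<close> and \<open>exp ((b - m2 a / 2) t)\<close>; for \<open>a = m1 + 2\<close> and \<open>b = m2 + 2\<close>
  both exponents are \<open>(2 - m1 m2 / 2) t\<close>.\<close>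

lemma weighted_grad_stretch:
  assumes "C_diff (Suc 0) u"
  shows "weighted_grad m1 m2
      (\<lambda>z. u (exp ((real m1 + 2) * t) * fst z, exp ((real m2 + 2) * t) * snd z)) z =
    exp ((2 - real m1 * real m2 / 2) * t) *\<^sub>R
      weighted_grad m1 m2 u (exp ((real m1 + 2) * t) * fst z, exp ((real m2 + 2) * t) * snd z)"
proof -
  have root: "sqrt \<bar>exp s * y\<bar> ^ m = exp (real m * (s / 2)) * sqrt \<bar>y\<bar> ^ m" for s y m
  proof -
    have "sqrt (exp s) = exp (s / 2)"
      by (rule real_sqrt_unique) (simp_all flip: exp_double)
    then show ?thesis
      by (simp add: abs_mult real_sqrt_mult power_mult_distrib flip: exp_of_nat_mult)
  qed
  define E1 E2 c where "E1 = exp ((real m1 + 2) * t)" and "E2 = exp ((real m2 + 2) * t)"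
    and "c = exp ((2 - real m1 * real m2 / 2) * t)"
  have E: "E1 = c * exp (real m1 * ((real m2 + 2) * t / 2))"
    "E2 = c * exp (real m2 * ((real m1 + 2) * t / 2))"
    unfolding E1_def E2_def c_def by (simp_all flip: exp_add add: field_simps)
  have w: "sqrt \<bar>E2 * y\<bar> ^ m1 = exp (real m1 * ((real m2 + 2) * t / 2)) * sqrt \<bar>y\<bar> ^ m1"
    "sqrt \<bar>E1 * y\<bar> ^ m2 = exp (real m2 * ((real m1 + 2) * t / 2)) * sqrt \<bar>y\<bar> ^ m2" for y
    unfolding E1_def E2_def by (rule root)+
  have "sqrt \<bar>y\<bar> ^ m1 * (E1 * d) = c * (sqrt \<bar>E2 * y\<bar> ^ m1 * d)"
    "sqrt \<bar>y\<bar> ^ m2 * (E2 * d) = c * (sqrt \<bar>E1 * y\<bar> ^ m2 * d)" for y d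
    unfolding w by (simp_all add: E)
  then show ?thesis
    unfolding E1_def[symmetric] E2_def[symmetric] c_def[symmetric]
    by (simp add: weighted_grad_def stretch_partials[OF assms])
qed

text \<open>The preimage of \<open>\<Omega>\<close> under the dilation is the image of \<open>\<Omega>\<close> under the flow at time \<open>t\<close>. It
  is an open subset of the closure of \<open>\<Omega>\<close>, hence contained in the interior of that closure,
  which is \<open>\<Omega>\<close>.\<close>

lemma stretch_preimage_subset:
  assumes "open \<Omega>" "connected \<Omega>" "piecewise_C1_boundary \<Omega>" "D_star_shaped m1 m2 \<Omega>" "t \<ge> 0"
  shows "(\<lambda>z. (exp ((real m1 + 2) * t) * fst z, exp ((real m2 + 2) * t) * snd z)) -` \<Omega> \<subseteq> \<Omega>"
    (is "?h -` \<Omega> \<subseteq> \<Omega>")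
proof -
  have "continuous_on UNIV ?h"
    by (intro continuous_intros)
  then have "open (?h -` \<Omega>)"
    using assms(1) by (rule open_vimage[rotated])
  moreover have "z \<in> closure \<Omega>" if "?h z \<in> \<Omega>" for z
  proof -
    have "?h z \<in> closure \<Omega>" "ereal t \<in> {0..\<infinity>}"
      using that closure_subset assms(5) by auto
    then have "D_flow m1 m2 (ereal t) (?h z) \<in> closure \<Omega>"
      using assms(4) unfolding D_star_shaped_def by blast
    moreover have "D_flow m1 m2 (ereal t) (?h z) = z"
      by (simp add: D_flow_def exp_minus prod_eq_iff)
    ultimately show ?thesis by simp
  qed
  ultimately have "?h -` \<Omega> \<subseteq> interior (closure \<Omega>)"
    by (intro interior_maximal) auto
  then show ?thesis
    using interior_closure_Jordan_domain[OF assms(1-3)] by simp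
qed

lemma stretch_in_C0_infinity:
  assumes "u \<in> C0_infinity \<Omega>" "bounded \<Omega>"
    and "(\<lambda>z. (\<alpha> * fst z, \<beta> * snd z)) -` \<Omega> \<subseteq> \<Omega>"
  shows "(\<lambda>z. u (\<alpha> * fst z, \<beta> * snd z)) \<in> C0_infinity \<Omega>"
proof -
  define h where "h z = (\<alpha> * fst z, \<beta> * snd z)" for z :: "real \<times> real"
  define K where "K = closure {z. u z \<noteq> 0}"
  have "continuous_on UNIV h"
    unfolding h_def by (intro continuous_intros)
  then have "closed (h -` K)"
    by (intro closed_vimage) (auto simp: K_def)
  moreover have "{z. u (h z) \<noteq> 0} \<subseteq> h -` K"
    unfolding K_def using closure_subset[of "{z. u z \<noteq> 0}"] by blast
  ultimately have "closure {z. u (h z) \<noteq> 0} \<subseteq> h -` K"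
    by (intro closure_minimal)
  also have "\<dots> \<subseteq> h -` \<Omega>"
    using assms(1) by (auto simp: K_def C0_infinity_def)
  also have "\<dots> \<subseteq> \<Omega>"
    using assms(3) by (simp add: h_def[abs_def])
  finally have sub: "closure {z. u (h z) \<noteq> 0} \<subseteq> \<Omega>" .
  then have "compact (closure {z. u (h z) \<noteq> 0})"
    using assms(2) by (metis bounded_subset closed_closure compact_eq_bounded_closed)
  then show ?thesis
    using sub assms(1) by (auto simp: C0_infinity_def h_def[abs_def] intro: C_diff_stretch)
qed

section \<open>The critical exponent\<close>

lemma exp_growth_bounded_imp_nonpos:
  fixes e M :: real
  assumes "\<And>t. t \<ge> 0 \<Longrightarrow> exp (e * t) \<le> M"
  shows "e \<le> 0"
proof (rule ccontr)
  assume "\<not> e \<le> 0"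
  moreover have "M \<ge> 1" using assms[of 0] by simp
  \<comment> \<open>At \<open>t = M / e\<close> the bound reads \<open>exp M \<le> M\<close>.\<close>
  ultimately have "exp M \<le> M" using assms[of "M / e"] by simp
  then show False using exp_ge_add_one_self[of M] by linarith
qed

theorem proposition1:
  fixes m1 m2 :: nat and \<Omega> :: "(real \<times> real) set" and p :: real
  assumes "\<not> (m1 = 0 \<and> m2 = 0)"
    and "\<Omega> \<noteq> {}" and "bounded \<Omega>" and "open \<Omega>" and "simply_connected \<Omega>"
    and "piecewise_C1_boundary \<Omega>"
    and "D_star_shaped m1 m2 \<Omega>"
    and "p \<ge> 1"
    and "\<exists>C>0. \<forall>u\<in>C0_infinity \<Omega>.
           Lp_norm p \<Omega> u \<le> C * Lp_norm 2 \<Omega> (weighted_grad m1 m2 u)"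
  shows "1 \<le> p \<and> p \<le> critical_exponent m1 m2"
proof -
  obtain C where C: "C > 0" "\<And>u. u \<in> C0_infinity \<Omega> \<Longrightarrow>
      Lp_norm p \<Omega> u \<le> C * Lp_norm 2 \<Omega> (weighted_grad m1 m2 u)"
    using assms(9) by blast
  obtain u where u: "u \<in> C0_infinity \<Omega>" "{z. u z \<noteq> 0} \<noteq> {}"
    using exists_bump_in_open_set[OF assms(4,2)] by metis
  have smooth: "C_diff k u" for k
    using u(1) by (simp add: C0_infinity_def)
  have contu: "continuous_on UNIV u"
    using smooth C_diff_imp_continuous by blast
  have contw: "continuous_on UNIV (weighted_grad m1 m2 u)"
  proof -
    have "continuous_on UNIV (partial_x u)" "continuous_on UNIV (partial_y u)"
      using smooth[of "Suc 0"] by simp_all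
    then show ?thesis
      unfolding weighted_grad_def by (intro continuous_intros)
  qed
  have zero_outside: "v z = 0" "weighted_grad m1 m2 v z = 0"
    if "v \<in> C0_infinity \<Omega>" "z \<notin> \<Omega>" for v z
  proof -
    have "z \<notin> closure {z. v z \<noteq> 0}"
      using that by (auto simp: C0_infinity_def)
    then show "v z = 0" "weighted_grad m1 m2 v z = 0"
      using gradient_zero_outside_support[of z v] closure_subset[of "{z. v z \<noteq> 0}"]
      by (auto simp: weighted_grad_def zero_prod_def)
  qed
  define a b Q where "a = real m1 + 2" and "b = real m2 + 2"
    and "Q = real m1 + real m2 + real m1 * real m2"
  define A B where "A = Lp_norm p UNIV u" and "B = Lp_norm 2 UNIV (weighted_grad m1 m2 u)"
  have "A > 0"
    unfolding A_def using Lp_norm_pos[OF u] assms(8) by simp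
  have "exp ((Q / 2 - (a + b) / p) * t) \<le> C * B / A" if "t \<ge> 0" for t
  proof -
    define h where "h z = (exp (a * t) * fst z, exp (b * t) * snd z)" for z :: "real \<times> real"
    define v where "v z = u (h z)" for z
    have v: "v \<in> C0_infinity \<Omega>"
      unfolding v_def[abs_def] h_def a_def b_def
      using u(1) assms simply_connected_imp_connected that
      by (intro stretch_in_C0_infinity stretch_preimage_subset) auto
    \<comment> \<open>The contribution of the Jacobian to an \<open>L\<^sup>r\<close> norm.\<close>
    have vol: "(exp (a * t) * exp (b * t)) powr (- (1 / r)) = exp (- ((a + b) * t / r))" for r
      by (simp add: powr_def ln_mult field_simps)
    have "Lp_norm p \<Omega> v = exp (- ((a + b) * t / p)) * A"
    proof -
      have "Lp_norm p \<Omega> v = Lp_norm p UNIV (\<lambda>z. 1 *\<^sub>R u (h z))"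
        using Lp_norm_eq_UNIV[of \<Omega> v p] zero_outside[OF v] by (simp add: v_def[abs_def])
      also have "\<dots> = \<bar>1\<bar> * (exp (a * t) * exp (b * t)) powr (- (1 / p)) * A"
        unfolding h_def A_def by (rule Lp_norm_stretch[OF contu]) (use assms(8) in auto)
      finally show ?thesis by (simp add: vol)
    qed
    moreover have "Lp_norm 2 \<Omega> (weighted_grad m1 m2 v) = exp (- (Q * t / 2)) * B"
    proof -
      define c where "c = exp ((2 - real m1 * real m2 / 2) * t)"
      have "weighted_grad m1 m2 v = (\<lambda>z. c *\<^sub>R weighted_grad m1 m2 u (h z))"
        unfolding v_def[abs_def] h_def c_def a_def b_def
        by (rule ext) (rule weighted_grad_stretch[OF smooth])
      then have "Lp_norm 2 \<Omega> (weighted_grad m1 m2 v) =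
          Lp_norm 2 UNIV (\<lambda>z. c *\<^sub>R weighted_grad m1 m2 u (h z))"
        using Lp_norm_eq_UNIV[of \<Omega> "weighted_grad m1 m2 v" 2] zero_outside[OF v] by simp
      also have "\<dots> = \<bar>c\<bar> * (exp (a * t) * exp (b * t)) powr (- (1 / 2)) * B"
        unfolding h_def B_def by (rule Lp_norm_stretch[OF contw]) auto
      also have "\<bar>c\<bar> * (exp (a * t) * exp (b * t)) powr (- (1 / 2)) = exp (- (Q * t / 2))"
        unfolding vol unfolding c_def a_def b_def Q_def
        by (simp flip: exp_add) (simp add: field_simps)
      finally show ?thesis .
    qed
    ultimately have "exp (- ((a + b) * t / p)) * A \<le> C * (exp (- (Q * t / 2)) * B)"
      using C(2)[OF v] by simp
    then have "exp (Q * t / 2) * (exp (- ((a + b) * t / p)) * A) \<le>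
        exp (Q * t / 2) * (C * (exp (- (Q * t / 2)) * B))"
      by (rule mult_left_mono) simp
    also have "\<dots> = C * B"
      by (simp add: exp_minus)
    also have "exp (Q * t / 2) * (exp (- ((a + b) * t / p)) * A) =
        exp ((Q / 2 - (a + b) / p) * t) * A"
      by (simp flip: exp_add mult.assoc add: algebra_simps)
    finally show ?thesis
      using \<open>A > 0\<close> by (simp add: field_simps)
  qed
  then have "Q / 2 - (a + b) / p \<le> 0"
    by (rule exp_growth_bounded_imp_nonpos)
  moreover have "Q > 0"
    using assms(1) unfolding Q_def by (cases "m1 = 0") (auto intro!: add_pos_nonneg)
  ultimately have "p \<le> 2 * (a + b) / Q"
    using assms(8) by (simp add: field_simps)
  also have "\<dots> = critical_exponent m1 m2"
    by (simp add: critical_exponent_def a_def b_def Q_def algebra_simps)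
  finally show ?thesis
    using assms(8) by simp
qed

end
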